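(* Let $x^\ast$ be a local minimizer of the constrained problem $$\min_{x\in\mathcal X} f(x)\quad\text{subject to } c_i(x)=0\ (i\in\mathcal E),\quad c_i(x)\ge 0\ (i\in\mathcal I),$$ with feasible set $\Omega$. If the objective function $f$ is differentiable at $x^\ast$, then $$d^\top\nabla f(x^\ast)\ge 0\quad\text{for all } d\in T_\Omega(x^\ast),$$ which is equivalent to $$T_\Omega(x^\ast)\cap\{d\in\mathbb R^n : d^\top\nabla f(x^\ast)<0\}=\varnothing .$$
   Context: Setting: $\mathcal X\subseteq\mathbb R^n$ is a set, $\mathcal E$ and $\mathcal I$ are disjoint finite index sets, and $f:\mathbb R^n\to\mathbb R$ and $c_i:\mathbb R^n\to\mathbb R$ ($i\in\mathcal E\cup\mathcal I$) are real-valued functions. The feasible set is $\Omega=\{x\in\mathcal X : c_i(x)=0\ \forall i\in\mathcal E,\ c_i(x)\ge 0\ \forall i\in\mathcal I\}$. A local minimizer of the problem is a point $x^\ast\in\Omega$ such that $f(x^\ast)\le f(x)$ for all $x\in\Omega$ in some neighborhood of $x^\ast$. Tangent cone: a vector $d$ is a tangent vector to $\Omega$ at $x$ if there exist a feasible sequence $\{z_k\}$ (that is, $z_k\in\Omega$ for all sufficiently large $k$) converging to $x$ and a sequence of positive scalars $t_k\to 0$ with $\lim_{k\to\infty}(z_k-x)/t_k=d$. The set of all tangent vectors to $\Omega$ at $x$ is denoted $T_\Omega(x)$. *)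

theory Defs
  imports "HOL-Analysis.Analysis"
begin

definition feasible_set ::
    "(real ^ 'n) set \<Rightarrow> 'i set \<Rightarrow> 'i set \<Rightarrow> ('i \<Rightarrow> real ^ 'n \<Rightarrow> real) \<Rightarrow> (real ^ 'n) set" where
  "feasible_set X E I c = {x \<in> X. (\<forall>i\<in>E. c i x = 0) \<and> (\<forall>i\<in>I. c i x \<ge> 0)}"

definition local_minimizer ::
    "(real ^ 'n \<Rightarrow> real) \<Rightarrow> (real ^ 'n) set \<Rightarrow> real ^ 'n \<Rightarrow> bool" where
  "local_minimizer f \<Omega> x \<longleftrightarrow>
     x \<in> \<Omega> \<and> (\<exists>N. open N \<and> x \<in> N \<and> (\<forall>y \<in> \<Omega> \<inter> N. f x \<le> f y))"

definition tangent_vector :: "(real ^ 'n) set \<Rightarrow> real ^ 'n \<Rightarrow> real ^ 'n \<Rightarrow> bool" where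
  "tangent_vector \<Omega> x d \<longleftrightarrow>
     (\<exists>z t. (\<forall>\<^sub>F k in sequentially. z k \<in> \<Omega>) \<and> z \<longlonglongrightarrow> x \<and>
            (\<forall>k. t k > 0) \<and> t \<longlonglongrightarrow> 0 \<and>
            (\<lambda>k. (z k - x) /\<^sub>R t k) \<longlonglongrightarrow> d)"

definition tangent_cone :: "(real ^ 'n) set \<Rightarrow> real ^ 'n \<Rightarrow> (real ^ 'n) set" where
  "tangent_cone \<Omega> x = {d. tangent_vector \<Omega> x d}"

(* Meaningful only where f is differentiable; there the vector g is unique. *)
definition gradient :: "(real ^ 'n \<Rightarrow> real) \<Rightarrow> real ^ 'n \<Rightarrow> real ^ 'n" where
  "gradient f x = (THE g. GDERIV f x :> g)"

end

theory Submission
  imports Defs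
begin

text \<open>
  If \<open>z k \<in> \<Omega>\<close> and \<open>t k > 0\<close> witness that \<open>d\<close> is tangent to \<open>\<Omega>\<close> at a local minimizer \<open>x\<close>,
  then the quotients \<open>(f (z k) - f x) / t k\<close> are eventually nonnegative, because \<open>z k\<close> is a
  feasible point close to \<open>x\<close>. Differentiability at \<open>x\<close> alone makes these quotients converge to
  the directional derivative \<open>d \<bullet> \<nabla>f(x)\<close> (\<open>difference_quotient_along_tangent_sequence\<close>),
  which is therefore nonnegative too.
\<close>

text \<open>
  Existence is the Riesz representation of the derivative, with the adjoint applied to \<open>1\<close> as
  the representing vector. Uniqueness is what makes the definite description in the definition
  of the gradient denote that vector.
\<close>

lemma GDERIV_gradient:
  fixes f :: "real ^ 'n \<Rightarrow> real"
  assumes "f differentiable (at x)"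
  shows "GDERIV f x :> gradient f x"
proof -
  obtain D where D: "(f has_derivative D) (at x)"
    using assms unfolding differentiable_def by blast
  then have "linear D"
    by (rule has_derivative_linear)
  then have "D = (\<lambda>h. h \<bullet> adjoint D 1)"
    using adjoint_works[of D _ "1 :: real"] by simp
  with D have ex: "GDERIV f x :> adjoint D 1"
    unfolding gderiv_def by metis
  have unique: "g = adjoint D 1" if "GDERIV f x :> g" for g
  proof -
    have "(\<lambda>h. h \<bullet> g) = (\<lambda>h. h \<bullet> adjoint D 1)"
      using that ex unfolding gderiv_def by (rule has_derivative_unique)
    then have "\<forall>h. h \<bullet> g = h \<bullet> adjoint D 1"
      by metis
    then show ?thesis
      by (simp only: vector_eq_ldot)
  qed
  show ?thesis
    unfolding gradient_def using ex unique by (rule theI)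
qed

text \<open>
  The remainder of the first-order expansion, divided by \<open>t k\<close>, is the relative remainder at
  \<open>z k\<close>, which tends to \<open>0\<close>, times the norm of \<open>(z k - x) / t k\<close>, which converges. Hence the
  directional derivative is reached along curved approaches to \<open>x\<close>, not only along rays.
\<close>

lemma difference_quotient_along_tangent_sequence:
  fixes f :: "'a::real_normed_vector \<Rightarrow> real"
  assumes f: "(f has_derivative D) (at x)"
    and z: "z \<longlonglongrightarrow> x"
    and t: "\<And>k. t k > 0"
    and d: "(\<lambda>k. (z k - x) /\<^sub>R t k) \<longlonglongrightarrow> d"
  shows "(\<lambda>k. (f (z k) - f x) / t k) \<longlonglongrightarrow> D d"
proof -
  interpret D: bounded_linear D
    using f by (rule has_derivative_bounded_linear)
  define r where "r y = (f y - f x - D (y - x)) / norm (y - x)" for y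
  have "((\<lambda>y. norm (f y - f x - D (y - x)) / norm (y - x)) \<longlongrightarrow> 0) (at x)"
    using f by (simp add: has_derivative_iff_norm)
  then have "(r \<longlongrightarrow> 0) (at x)"
    by (intro tendsto_norm_zero_cancel[of r]) (simp add: r_def)
  \<comment> \<open>Division by zero gives \<open>r x = 0\<close>, so \<open>r\<close> is continuous at \<open>x\<close> and terms with
      \<open>z k = x\<close> need no separate treatment.\<close>
  then have "isCont r x"
    by (simp add: isCont_def r_def)
  from isCont_tendsto_compose[OF this z] have rz: "(\<lambda>k. r (z k)) \<longlonglongrightarrow> 0"
    by (simp add: r_def)
  have expansion: "(f (z k) - f x) / t k =
      D ((z k - x) /\<^sub>R t k) + r (z k) * norm ((z k - x) /\<^sub>R t k)" for k
  proof (cases "z k = x")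
    case True
    then show ?thesis by (simp add: D.zero)
  next
    case False
    then have "r (z k) * norm (z k - x) = f (z k) - f x - D (z k - x)"
      by (simp add: r_def)
    moreover have "norm ((z k - x) /\<^sub>R t k) = norm (z k - x) / t k"
      using t[of k] by (simp add: divide_inverse_commute)
    moreover have "D ((z k - x) /\<^sub>R t k) = D (z k - x) / t k"
      by (simp add: D.scaleR divide_inverse_commute)
    ultimately show ?thesis
      by (simp flip: add_divide_distrib)
  qed
  have "(\<lambda>k. D ((z k - x) /\<^sub>R t k) + r (z k) * norm ((z k - x) /\<^sub>R t k))
      \<longlonglongrightarrow> D d + 0 * norm d"
    by (intro tendsto_add tendsto_mult tendsto_norm D.tendsto d rz)
  then show ?thesis
    by (simp add: expansion)
qed

lemma local_minimizer_gradient_nonneg: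
  fixes f :: "real ^ 'n \<Rightarrow> real"
  assumes min: "local_minimizer f \<Omega> x"
    and f: "f differentiable (at x)"
    and d: "d \<in> tangent_cone \<Omega> x"
  shows "d \<bullet> gradient f x \<ge> 0"
proof -
  obtain z t where z_in: "\<forall>\<^sub>F k in sequentially. z k \<in> \<Omega>" and z: "z \<longlonglongrightarrow> x"
    and t: "\<And>k. t k > (0::real)" and quot: "(\<lambda>k. (z k - x) /\<^sub>R t k) \<longlonglongrightarrow> d"
    using d unfolding tangent_cone_def tangent_vector_def by blast
  obtain N where N: "open N" "x \<in> N" "\<forall>y \<in> \<Omega> \<inter> N. f x \<le> f y"
    using min unfolding local_minimizer_def by blast
  have "(f has_derivative (\<lambda>h. h \<bullet> gradient f x)) (at x)"
    using GDERIV_gradient[OF f] unfolding gderiv_def .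
  then have "(\<lambda>k. (f (z k) - f x) / t k) \<longlonglongrightarrow> d \<bullet> gradient f x"
    using z t quot by (rule difference_quotient_along_tangent_sequence)
  moreover have "\<forall>\<^sub>F k in sequentially. (f (z k) - f x) / t k \<ge> 0"
    using z_in topological_tendstoD[OF z N(1,2)]
  proof eventually_elim
    case (elim k)
    then show ?case
      using N(3) t[of k] by simp
  qed
  ultimately show ?thesis
    by (rule tendsto_lowerbound) simp
qed

theorem theorem2:
  fixes X :: "(real ^ 'n) set"
    and E I :: "'i set"
    and f :: "real ^ 'n \<Rightarrow> real"
    and c :: "'i \<Rightarrow> real ^ 'n \<Rightarrow> real"
    and xstar :: "real ^ 'n"
  assumes "finite E" and "finite I" and "E \<inter> I = {}"
    and "local_minimizer f (feasible_set X E I c) xstar"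
    and "f differentiable (at xstar)"
  shows "(\<forall>d \<in> tangent_cone (feasible_set X E I c) xstar. d \<bullet> gradient f xstar \<ge> 0) \<and>
         ((\<forall>d \<in> tangent_cone (feasible_set X E I c) xstar. d \<bullet> gradient f xstar \<ge> 0) \<longleftrightarrow>
          tangent_cone (feasible_set X E I c) xstar \<inter> {d. d \<bullet> gradient f xstar < 0} = {})"
proof
  show "\<forall>d \<in> tangent_cone (feasible_set X E I c) xstar. d \<bullet> gradient f xstar \<ge> 0"
    using local_minimizer_gradient_nonneg[OF assms(4,5)] by blast
  show "(\<forall>d \<in> tangent_cone (feasible_set X E I c) xstar. d \<bullet> gradient f xstar \<ge> 0) \<longleftrightarrow>
      tangent_cone (feasible_set X E I c) xstar \<inter> {d. d \<bullet> gradient f xstar < 0} = {}"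
    by (auto simp: disjoint_iff not_less)
qed

end
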